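(* The PageRank protocol (written out in the context) for computing the PageRank centrality uses $$\mathcal{O}\left((n^2+ml)\log^2(n)\right)$$ primitive operations, assuming the ORAM accesses are performed using the Circuit ORAM construction.
   Context: **Graphs and representation.** $G(V,E)$ is a directed graph with vertex set $V=\{1,\dots,n\}$ and $m=|E|$ edges, given in the edgelist representation $(\mathcal{E},Idx)$. $\mathcal{E}$ is an array of length $m+1$ containing the concatenated adjacency lists (out-neighbours) of all vertices (in the order $1,2,\dots,n$) and an empty element at the end. $Idx$ is an array of length $n$: $Idx[u]=i$ if out-degree$(u)\neq 0$ and $\mathcal{E}[i]$ is the first neighbour of $u$ in $\mathcal{E}$; $Idx[u]=Idx[u+1]$ if $u\neq n$ and out-degree$(u)=0$; $Idx[u]=m+1$ if $u=n$ and out-degree$(u)=0$. Convention: $Idx[n+1]=m+1$. **PageRank (iterative method).** Let $od(i)$ be the out-degree of $i$, $s$ the redistribution parameter and $l$ the number of iterations. The update matrix $N=[N_{ij}]$ is the $n\times n$ matrix with $N_{ij}=s/od(i)+(1-s)/n$ if $(i,j)\in E$ and $N_{ij}=(1-s)/n$ otherwise. Starting from $r_i^{(0)}=1/n$ for all $i$, the PageRank value of node $i$ after $k$ iterations is $r_i^{(k)}=\sum_{j=1}^n N_{ji}\,r_j^{(k-1)}$. **Cost model.** Efficiency is measured by the number of primitive operations; addition, subtraction, multiplication, division, comparison and equality check on integers and rationals are primitive operations. The arrays $\overset{\sim}{N},\mathcal{E},Idx,\overset{\sim}{r}^{(0)},\overset{\sim}{r}^{(1)}$ are stored in an Oblivious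 RAM (ORAM), which allows array accesses at secret indices. With the Circuit ORAM construction each block access to an ORAM array of size $M$ is performed in $\mathcal{O}(\log^2 M)$ operations. The if-else construct is executed by running both branches one after the other, one of them in a dummy fashion. **The PageRank protocol.** Input: $(\mathcal{E},Idx)$, $l$, $s$. Output: the PageRank values of all vertices of $G$. 1. For $i=1$ to $n$, for $j=1$ to $n$: if $Idx[i]==Idx[i+1]$ then $\overset{\sim}{N}[i][j]\leftarrow(1-s)/n$; else $\overset{\sim}{N}[i][j]\leftarrow s/(Idx[i+1]-Idx[i])+(1-s)/n$. 2. $\overset{\sim}{r}^{(0)}[i]\leftarrow 1/n$ and $\overset{\sim}{r}^{(1)}[i]\leftarrow 0$ for $1\le i\le n$. $j\leftarrow 1$. 3. For $k=1$ to $l$: - $v\leftarrow 1$. - For $i=1$ to $m$: { if $i==Idx[v+1]$ then $v\leftarrow v+1$; then, in every case, $\overset{\sim}{r}^{(j)}[\mathcal{E}[i]]\leftarrow\overset{\sim}{r}^{(j)}[\mathcal{E}[i]]+\overset{\sim}{N}[v][\mathcal{E}[i]]*\overset{\sim}{r}^{(1-j)}[v]$ }. - $j\leftarrow 1-j$; then $\overset{\sim}{r}^{(j)}[i]\leftarrow 0$ for $1\le i\le n$.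
   Formalization: Proved for n ≥ 2 and, for any fixed K (the constant depends on K), when n ≤ K·m or l ≤ K·n; otherwise false, since each round resets n entries: with n = 2, m = 0 and l → ∞ the cost grows with l but the bound does not. *)

theory Defs
  imports
    Complex_Main
    "HOL-Library.Landau_Symbols"
    "HOL-Library.State_Monad"
    "Graph_Theory.Pair_Digraph"
begin

(* The state of the monad is the number of primitive operations performed so far.  Copying a
   value into a local variable and fixing the next operation to perform are not primitive
   operations, hence free. *)

type_synonym 'a comp = "(nat, 'a) state"

definition tick :: "nat \<Rightarrow> unit comp" where
  "tick k = State_Monad.update (\<lambda>c. c + k)"

definition op_count :: "'a comp \<Rightarrow> nat" where
  "op_count p = snd (run_state p 0)"

(* Only ever applied to one of +, -, *, / and = on scalars. *)
definition prim :: "('a \<Rightarrow> 'b \<Rightarrow> 'c) \<Rightarrow> 'a \<Rightarrow> 'b \<Rightarrow> 'c comp" where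
  "prim f x y = do { tick 1; State_Monad.return (f x y) }"

(* Arrays are indexed from 1.  The number acc M is the number of primitive operations of one
   block access to an ORAM array with M blocks, whether it reads or writes. *)

definition oram_read :: "(nat \<Rightarrow> nat) \<Rightarrow> 'a list \<Rightarrow> nat \<Rightarrow> 'a comp" where
  "oram_read acc A i = do { tick (acc (length A)); State_Monad.return (A ! (i - 1)) }"

definition oram_write :: "(nat \<Rightarrow> nat) \<Rightarrow> 'a list \<Rightarrow> nat \<Rightarrow> 'a \<Rightarrow> 'a list comp" where
  "oram_write acc A i x = do { tick (acc (length A)); State_Monad.return (A[i - 1 := x]) }"

(* Both branches are run; since values are persistent, the dummy run of the branch not taken
   only leaves its cost behind. *)
definition if_else :: "bool \<Rightarrow> 'a comp \<Rightarrow> 'a comp \<Rightarrow> 'a comp" where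
  "if_else b p q = do { x \<leftarrow> p; y \<leftarrow> q; State_Monad.return (if b then x else y) }"

(* Each iteration pays for the comparison of the counter with its bound and for its increment;
   leaving the loop takes one further comparison. *)
primrec loop :: "nat list \<Rightarrow> (nat \<Rightarrow> 'a \<Rightarrow> 'a comp) \<Rightarrow> 'a \<Rightarrow> 'a comp" where
  "loop [] body x = do { tick 1; State_Monad.return x }"
| "loop (i # is) body x = do { tick 2; y \<leftarrow> body i x; loop is body y }"

definition for_loop :: "nat \<Rightarrow> (nat \<Rightarrow> 'a \<Rightarrow> 'a comp) \<Rightarrow> 'a \<Rightarrow> 'a comp" where
  "for_loop b body x = loop [1..<b + 1] body x"

(* The order inside each adjacency list adj u is arbitrary.  The final empty element is 0,
   which is not a vertex. *)
definition edgelist_rep :: "nat \<Rightarrow> nat pair_pre_digraph \<Rightarrow> nat list \<Rightarrow> nat list \<Rightarrow> bool" where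
  "edgelist_rep n G Ed Idx \<longleftrightarrow>
     (\<exists>adj. (\<forall>u\<in>{1..n}. distinct (adj u) \<and> set (adj u) = {w. (u, w) \<in> parcs G}) \<and>
        Ed = concat (map adj [1..<n + 1]) @ [0] \<and>
        length Idx = n \<and>
        (\<forall>u\<in>{1..n}. Idx ! (u - 1) =
           (if out_degree (with_proj G) u \<noteq> 0 then length (concat (map adj [1..<u])) + 1
            else if u \<noteq> n then Idx ! u
            else card (parcs G) + 1)))"

(* The n x n array N is one ORAM array with n^2 blocks in row-major order. *)
definition cell :: "nat \<Rightarrow> nat \<Rightarrow> nat \<Rightarrow> nat comp" where
  "cell n i j = do { a \<leftarrow> prim (-) i 1; b \<leftarrow> prim (*) a n; prim (+) b j }"

(* The table IdxT is Idx together with the conventional entry Idx[n+1] = m+1. *)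
definition pr_matrix ::
  "(nat \<Rightarrow> nat) \<Rightarrow> nat \<Rightarrow> nat list \<Rightarrow> rat \<Rightarrow> rat list comp" where
  "pr_matrix acc n IdxT s =
     for_loop n (\<lambda>i. for_loop n (\<lambda>j N. do {
         a \<leftarrow> oram_read acc IdxT i;
         i' \<leftarrow> prim (+) i 1;
         b \<leftarrow> oram_read acc IdxT i';
         c \<leftarrow> prim (=) a b;
         if_else c
           (do {
              t \<leftarrow> prim (-) 1 s;
              t \<leftarrow> prim (/) t (of_nat n);
              p \<leftarrow> cell n i j;
              oram_write acc N p t
            })
           (do {
              b \<leftarrow> oram_read acc IdxT i';
              a \<leftarrow> oram_read acc IdxT i;
              d \<leftarrow> prim (-) b a;
              x \<leftarrow> prim (/) s (of_nat d);
              t \<leftarrow> prim (-) 1 s;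
              t \<leftarrow> prim (/) t (of_nat n);
              y \<leftarrow> prim (+) x t;
              p \<leftarrow> cell n i j;
              oram_write acc N p y
            })
       })) (replicate (n * n) 0)"

definition fill :: "(nat \<Rightarrow> nat) \<Rightarrow> nat \<Rightarrow> rat comp \<Rightarrow> rat list \<Rightarrow> rat list comp" where
  "fill acc n e A = for_loop n (\<lambda>i A. do { x \<leftarrow> e; oram_write acc A i x }) A"

(* The two arrays r 0 and r 1 are given by the function r. *)
definition pr_edge_step ::
  "(nat \<Rightarrow> nat) \<Rightarrow> nat \<Rightarrow> nat list \<Rightarrow> nat list \<Rightarrow> rat list \<Rightarrow> nat \<Rightarrow> nat
     \<Rightarrow> nat \<times> (nat \<Rightarrow> rat list) \<Rightarrow> (nat \<times> (nat \<Rightarrow> rat list)) comp" where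
  "pr_edge_step acc n Ed IdxT N j i = (\<lambda>(v, r). do {
     v' \<leftarrow> prim (+) v 1;
     t \<leftarrow> oram_read acc IdxT v';
     c \<leftarrow> prim (=) i t;
     v \<leftarrow> if_else c (prim (+) v 1) (State_Monad.return v);
     u \<leftarrow> oram_read acc Ed i;
     x \<leftarrow> oram_read acc (r j) u;
     p \<leftarrow> cell n v u;
     w \<leftarrow> oram_read acc N p;
     j' \<leftarrow> prim (-) 1 j;
     y \<leftarrow> oram_read acc (r j') v;
     z \<leftarrow> prim (*) w y;
     z \<leftarrow> prim (+) x z;
     A \<leftarrow> oram_write acc (r j) u z;
     State_Monad.return (v, r(j := A))
   })"

definition pagerank_protocol ::
  "(nat \<Rightarrow> nat) \<Rightarrow> nat list \<Rightarrow> nat list \<Rightarrow> nat \<Rightarrow> rat \<Rightarrow> rat list comp" where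
  "pagerank_protocol acc Ed Idx l s =
     (let n = length Idx; m = length Ed - 1; IdxT = Idx @ [m + 1] in do {
        N \<leftarrow> pr_matrix acc n IdxT s;
        r0 \<leftarrow> fill acc n (prim (/) 1 (of_nat n)) (replicate n 0);
        r1 \<leftarrow> fill acc n (State_Monad.return 0) (replicate n 0);
        (j, r) \<leftarrow> for_loop l (\<lambda>k (j, r). do {
            (v, r) \<leftarrow> for_loop m (pr_edge_step acc n Ed IdxT N j) (1, r);
            j \<leftarrow> prim (-) 1 j;
            A \<leftarrow> fill acc n (State_Monad.return 0) (r j);
            State_Monad.return (j, r(j := A))
          }) (1, (\<lambda>_. [])(0 := r0, 1 := r1));
        j' \<leftarrow> prim (-) 1 j;
        State_Monad.return (r j')
      })"

end

theory Submission
  imports Defs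
begin

text \<open>The only property of the computed values that affects the cost is the length of the arrays.
  Writes preserve it and no array has more than \<open>n\<^sup>2 + 1\<close> blocks, so every access costs
  \<open>O(log\<^sup>2 n)\<close>. The protocol makes \<open>O(n\<^sup>2 + (m + n) l)\<close> accesses; the extra \<open>n l\<close> comes from
  resetting a rank vector in each iteration and is absorbed by \<open>m l\<close> if \<open>n \<le> K m\<close> and by
  \<open>n\<^sup>2\<close> if \<open>l \<le> K n\<close>.\<close>

section \<open>Composition rules for cost bounds\<close>

text \<open>Quantifying over the initial count \<open>c\<close> makes the bound usable in the middle
  of a program. \<open>Q\<close> carries facts about the result, in particular array lengths, on
  which the cost of later accesses depends.\<close>

definition runs_within :: "'a comp \<Rightarrow> real \<Rightarrow> ('a \<Rightarrow> bool) \<Rightarrow> bool" where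
  "runs_within p k Q \<longleftrightarrow>
     (\<forall>c. real (snd (run_state p c)) \<le> real c + k \<and> Q (fst (run_state p c)))"

lemma runs_within_return: "Q x \<Longrightarrow> runs_within (State_Monad.return x) 0 Q"
  by (simp add: runs_within_def State_Monad.return_def)

lemma runs_within_tick: "runs_within (tick k) (real k) (\<lambda>_. True)"
  by (simp add: runs_within_def tick_def State_Monad.update_def State_Monad.bind_def
      State_Monad.get_def State_Monad.set_def)

text \<open>Applied first, it leaves the cost schematic: the composition rules accumulate it, and it
  is compared with the closed form only at the end.\<close>

lemma runs_within_mono:
  "\<lbrakk>runs_within p k Q; k \<le> k'; \<And>x. Q x \<Longrightarrow> Q' x\<rbrakk> \<Longrightarrow> runs_within p k' Q'"
  unfolding runs_within_def by (meson add_left_mono order_trans)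

text \<open>Costs simply add because \<open>k'\<close> is uniform over all intermediate results
  satisfying \<open>Q\<close>.\<close>

lemma runs_within_bind:
  assumes "runs_within p k Q" and "\<And>x. Q x \<Longrightarrow> runs_within (f x) k' R"
  shows "runs_within (State_Monad.bind p f) (k + k') R"
proof -
  have "real (snd (run_state (f (fst (run_state p c))) (snd (run_state p c)))) \<le> real c + (k + k')
      \<and> R (fst (run_state (f (fst (run_state p c))) (snd (run_state p c))))" for c
  proof -
    have "real (snd (run_state p c)) \<le> real c + k" "Q (fst (run_state p c))"
      using assms(1) by (auto simp: runs_within_def)
    then show ?thesis
      using assms(2)[of "fst (run_state p c)"] unfolding runs_within_def
      by (smt (verit))
  qed
  then show ?thesis
    by (simp add: runs_within_def State_Monad.bind_def case_prod_beta)
qed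

lemma runs_within_prim: "runs_within (prim f x y) 1 (\<lambda>_. True)"
  unfolding prim_def
  by (rule runs_within_mono[OF runs_within_bind[OF runs_within_tick runs_within_return]]) auto

text \<open>The branch not taken is charged as well, so the bound is a sum rather than a
  maximum.\<close>

lemma runs_within_if_else:
  assumes "runs_within p k Q" and "runs_within q k' Q"
  shows "runs_within (if_else b p q) (k + k') Q"
  unfolding if_else_def
  by (rule runs_within_mono[OF runs_within_bind[OF assms(1) runs_within_bind[OF assms(2)
          runs_within_return[of Q]]]]) auto

text \<open>\<open>I\<close> is the loop invariant. The 2 pays for the comparison and increment of
  the counter, the 1 for the comparison on exit.\<close>

lemma runs_within_loop:
  assumes "\<And>i x. I x \<Longrightarrow> runs_within (body i x) k I" and "I x"
  shows "runs_within (loop is body x) (real (length is) * (k + 2) + 1) I"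
  using assms(2)
proof (induction "is" arbitrary: x)
  case Nil
  show ?case
    by (simp, rule runs_within_mono[OF runs_within_bind[OF runs_within_tick
            runs_within_return[of I]]]) (use Nil in auto)
next
  case (Cons i "is")
  show ?case
    by (simp, rule runs_within_mono[OF runs_within_bind[OF runs_within_tick
            runs_within_bind[OF assms(1) Cons.IH]]]) (use Cons.prems in \<open>auto simp: algebra_simps\<close>)
qed

lemma runs_within_for_loop:
  assumes "\<And>i x. I x \<Longrightarrow> runs_within (body i x) k I" and "I x"
  shows "runs_within (for_loop b body x) (real b * (k + 2) + 1) I"
  using runs_within_loop[of I body k x "[1..<b + 1]"] assms by (simp add: for_loop_def del: upt_Suc)

lemma runs_within_case_prod:
  assumes "P x" and "\<And>a b. P (a, b) \<Longrightarrow> runs_within (f a b) k Q"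
  shows "runs_within (case x of (a, b) \<Rightarrow> f a b) k Q"
  using assms by (cases x) auto

lemma runs_within_cell: "runs_within (cell n i j) 3 (\<lambda>_. True)"
  unfolding cell_def
  by (rule runs_within_mono, (rule runs_within_bind runs_within_prim)+) auto

section \<open>Cost of the protocol given a bound on one access\<close>

text \<open>\<open>S\<close> bounds the sizes of all arrays. The bound \<open>B\<close> is required
  at every size up to \<open>S\<close>, since \<open>acc\<close> need not be monotone.\<close>

locale oram_cost =
  fixes acc :: "nat \<Rightarrow> nat" and S :: nat and B :: real
  assumes acc_le: "M \<le> S \<Longrightarrow> real (acc M) \<le> B"
begin

lemma runs_within_oram_read:
  "length A \<le> S \<Longrightarrow> runs_within (oram_read acc A i) B (\<lambda>_. True)"
  unfolding oram_read_def
  by (rule runs_within_mono[OF runs_within_bind[OF runs_within_tick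
          runs_within_return[of "\<lambda>_. True"]]]) (auto intro: acc_le)

lemma runs_within_oram_write:
  "length A \<le> S \<Longrightarrow> runs_within (oram_write acc A i x) B (\<lambda>A. length A \<le> S)"
  unfolding oram_write_def
  by (rule runs_within_mono[OF runs_within_bind[OF runs_within_tick
          runs_within_return[of "\<lambda>A. length A \<le> S"]]]) (auto intro: acc_le)

lemmas runs_within_rules = runs_within_bind runs_within_prim runs_within_cell
  runs_within_if_else runs_within_oram_read runs_within_oram_write

lemma runs_within_pr_matrix:
  assumes "length IdxT \<le> S" and "n * n \<le> S"
  shows "runs_within (pr_matrix acc n IdxT s)
           (real n * (real n * (6 * B + 17) + 3) + 1) (\<lambda>N. length N \<le> S)"
proof -
  \<comment> \<open>Per entry: two reads before the branching, one write in the first branch, two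
    reads and one write in the second. The 15 is 2 operations before the branching, 5 in the first
    branch and 8 in the second, each branch including the 3 of \<open>cell\<close>.\<close>
  have "runs_within (pr_matrix acc n IdxT s)
          (real n * ((real n * ((6 * B + 15) + 2) + 1) + 2) + 1) (\<lambda>N. length N \<le> S)"
    unfolding pr_matrix_def
    apply (rule runs_within_for_loop)
     apply (rule runs_within_for_loop)
      apply (rule runs_within_mono)
        apply (rule runs_within_rules assms | assumption)+
    using assms by auto
  then show ?thesis
    by (simp add: algebra_simps)
qed

lemma runs_within_fill:
  assumes "runs_within e k (\<lambda>_. True)" and "length A \<le> S"
  shows "runs_within (fill acc n e A) (real n * (k + B + 2) + 1) (\<lambda>A. length A \<le> S)"
  unfolding fill_def
  by (rule runs_within_for_loop) (rule runs_within_rules assms | assumption)+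

text \<open>Six accesses: reads of \<open>IdxT\<close>, \<open>Ed\<close>, \<open>r j\<close>,
  \<open>N\<close>, \<open>r j'\<close> and the write to \<open>r j\<close>. The invariant covers
  every index of \<open>r\<close> because \<open>j\<close> and \<open>j'\<close> are arbitrary
  naturals here, not only 0 and 1.\<close>

lemma runs_within_pr_edge_step:
  assumes "length Ed \<le> S" "length IdxT \<le> S" "length N \<le> S"
    and "\<forall>i. length (snd x i) \<le> S"
  shows "runs_within (pr_edge_step acc n Ed IdxT N j i x) (6 * B + 9)
           (\<lambda>x. \<forall>i. length (snd x i) \<le> S)"
proof -
  obtain v r where x: "x = (v, r)"
    by (cases x)
  have r: "length (r i) \<le> S" for i
    using assms(4) x by simp
  show ?thesis
    unfolding pr_edge_step_def x prod.case
    apply (rule runs_within_mono[where Q="\<lambda>x. \<forall>i. length (snd x i) \<le> S"])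
      apply (rule runs_within_rules assms(1-3) r runs_within_return[where Q="\<lambda>_. True", OF TrueI]
        runs_within_return[where Q="\<lambda>x. \<forall>i. length (snd x i) \<le> S"])+
      apply (use r in simp)
     apply simp
    apply simp
    done
qed

text \<open>The program repeats the body of the outer loop verbatim so that the lemma applies by
  unification. The 3 consists of two loop exits and the subtraction \<open>1 - j\<close>.\<close>

lemma runs_within_iteration:
  assumes "length Ed \<le> S" "length IdxT \<le> S" "length N \<le> S"
    and "\<forall>i. length (snd x i) \<le> S"
  shows "runs_within
     (case x of (j, r) \<Rightarrow> do {
            (v, r) \<leftarrow> for_loop m (pr_edge_step acc n Ed IdxT N j) (1, r);
            j \<leftarrow> prim (-) 1 j;
            A \<leftarrow> fill acc n (State_Monad.return 0) (r j);
            State_Monad.return (j, r(j := A))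
          })
     (real m * (6 * B + 11) + real n * (B + 2) + 3) (\<lambda>x. \<forall>i. length (snd x i) \<le> S)"
proof -
  obtain j r where x: "x = (j, r)"
    by (cases x)
  have edges: "runs_within (for_loop m (pr_edge_step acc n Ed IdxT N j) (1, r))
      (real m * ((6 * B + 9) + 2) + 1) (\<lambda>x. \<forall>i. length (snd x i) \<le> S)"
    by (rule runs_within_for_loop[where I="\<lambda>x. \<forall>i. length (snd x i) \<le> S"])
      (use assms(4) x in \<open>auto intro: runs_within_pr_edge_step[OF assms(1-3)]\<close>)
  show ?thesis
    unfolding x prod.case
    apply (rule runs_within_mono)
      apply (rule runs_within_bind[OF edges])
      apply (rule runs_within_case_prod[where P="\<lambda>x. \<forall>i. length (snd x i) \<le> S"], assumption)
      apply (rule runs_within_bind[OF runs_within_prim])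
      apply (rule runs_within_bind[OF runs_within_fill])
        apply (rule runs_within_return[where Q="\<lambda>_. True", OF TrueI])
       apply simp
      apply (rule runs_within_return[where Q="\<lambda>x. \<forall>i. length (snd x i) \<le> S"])
      apply (auto simp: algebra_simps)
    done
qed

text \<open>The first 5 counts the exits of the matrix loop, the two fills and the main loop, and
  the last subtraction; the other 5 is the 3 of an iteration plus 2 for loop control.\<close>

lemma runs_within_pagerank_protocol:
  assumes n: "n = length Idx" "n * n + 1 \<le> S" "n \<ge> 1" and m: "length Ed = m + 1" "m + 1 \<le> S"
  shows "runs_within (pagerank_protocol acc Ed Idx l s)
     (real n * (real n * (6 * B + 17) + 3) + real n * (2 * B + 5) + 5
       + real l * (real m * (6 * B + 11) + real n * (B + 2) + 5)) (\<lambda>_. True)"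
proof -
  have m': "length Ed - 1 = m" "length Ed \<le> S"
    using m by auto
  have "n \<le> n * n"
    using n(3) by simp
  then have "n + 1 \<le> S"
    using n(2) by linarith
  then have lens: "length (Idx @ [m + 1]) \<le> S" "n * n \<le> S" "length (replicate n (0::rat)) \<le> S"
    using n(1,2) by simp_all
  show ?thesis
    unfolding pagerank_protocol_def Let_def n(1)[symmetric] m'
    apply (rule runs_within_mono)
      apply (rule runs_within_bind[OF runs_within_pr_matrix[OF lens(1,2)]])
      apply (rule runs_within_bind[OF runs_within_fill[OF runs_within_prim lens(3)]])
      apply (rule runs_within_bind[OF runs_within_fill[OF
              runs_within_return[where Q="\<lambda>_. True", OF TrueI] lens(3)]])
      apply (rule runs_within_bind)
       apply (rule runs_within_for_loop[where I="\<lambda>x. \<forall>i. length (snd x i) \<le> S"])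
        apply (rule runs_within_iteration[OF m'(2) lens(1)], assumption, assumption)
       \<comment> \<open>Initially \<open>r\<close> is \<open>[]\<close> away from 0 and 1, so the
         invariant holds at all indices.\<close>
       apply simp
      apply (rule runs_within_case_prod[where P="\<lambda>_. True", OF TrueI])
      apply (rule runs_within_bind[OF runs_within_prim])
      apply (rule runs_within_return[where Q="\<lambda>_. True", OF TrueI])
     apply (simp_all add: algebra_simps)
    done
qed

end

section \<open>Array sizes and the growth of the access cost\<close>

text \<open>The protocol reads \<open>n\<close> and \<open>m\<close> off the array lengths. Each arc
  is counted once, in the list of its tail, because the adjacency lists are distinct and all tails
  lie in \<open>{1..n}\<close>.\<close>

lemma edgelist_length:
  assumes "pair_fin_digraph G" and "pverts G = {1..n}" and "edgelist_rep n G Ed Idx"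
  shows "length Idx = n" and "length Ed = card (parcs G) + 1" and "card (parcs G) \<le> n * n"
proof -
  interpret pair_fin_digraph G by fact
  obtain adj where adj: "\<And>u. u \<in> {1..n} \<Longrightarrow> distinct (adj u) \<and> set (adj u) = {w. (u, w) \<in> parcs G}"
    and Ed: "Ed = concat (map adj [1..<n + 1]) @ [0]" and "length Idx = n"
    using assms(3) unfolding edgelist_rep_def by blast
  then show "length Idx = n" by simp
  have sub: "parcs G \<subseteq> {1..n} \<times> {1..n}"
    using in_arcsD1 in_arcsD2 assms(2) by auto
  then have "card (parcs G) \<le> card ({1..n} \<times> {1..n})"
    by (intro card_mono) auto
  then show "card (parcs G) \<le> n * n" by simp
  have arcs: "parcs G = Sigma {1..n} (\<lambda>u. set (adj u))"
    using sub adj by auto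
  have "length (concat (map adj [1..<n + 1])) = (\<Sum>u\<in>{1..n}. length (adj u))"
    by (simp add: length_concat comp_def sum_list_distinct_conv_sum_set atLeastLessThanSuc_atLeastAtMost
        del: upt_Suc)
  also have "\<dots> = (\<Sum>u\<in>{1..n}. card (set (adj u)))"
    by (intro sum.cong) (use adj distinct_card in \<open>metis+\<close>)
  also have "\<dots> = card (parcs G)"
    unfolding arcs by (subst card_SigmaI) auto
  finally show "length Ed = card (parcs G) + 1"
    by (simp add: Ed del: upt_Suc)
qed

text \<open>Turns the asymptotic hypothesis into one constant valid for all sizes that occur,
  including small ones.\<close>

lemma oram_access_bound:
  assumes "(\<lambda>M. real (acc M)) \<in> O(\<lambda>M. (log 2 (real M))\<^sup>2)"
  obtains D where "D \<ge> 1"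
    and "\<And>n M. n \<ge> 2 \<Longrightarrow> M \<le> n * n + 1 \<Longrightarrow> real (acc M) \<le> D * (log 2 (real n))\<^sup>2"
proof -
  obtain c where c: "c > 0"
    and ev: "\<forall>\<^sub>F M in at_top. norm (real (acc M)) \<le> c * norm ((log 2 (real M))\<^sup>2)"
    using landau_o.bigE[OF assms] by blast
  then obtain M0 where M0: "\<And>M. M \<ge> M0 \<Longrightarrow> real (acc M) \<le> c * (log 2 (real M))\<^sup>2"
    by (auto simp: eventually_at_top_linorder)
  \<comment> \<open>The sum absorbs the sizes below the threshold \<open>M0\<close>,
    \<open>9 * c\<close> the larger ones, and the 1 ensures \<open>D \<ge> 1\<close>.\<close>
  define D where "D = 1 + 9 * c + (\<Sum>M\<le>M0. real (acc M))"
  have D: "D \<ge> 1 + 9 * c"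
    by (auto simp: D_def sum_nonneg)
  show ?thesis
  proof (rule that[of D])
    show "D \<ge> 1" using D c by simp
    fix n M :: nat
    assume n: "n \<ge> 2" and M: "M \<le> n * n + 1"
    have L: "log 2 (real n) \<ge> 1"
      using n by (simp add: le_log_iff)
    then have L2: "(log 2 (real n))\<^sup>2 \<ge> 1"
      by (simp add: one_le_power)
    show "real (acc M) \<le> D * (log 2 (real n))\<^sup>2"
    \<comment> \<open>The second case thus provides \<open>M > 0\<close>, needed for the logarithm
      to be monotone and nonnegative.\<close>
    proof (cases "M \<le> M0 \<or> M = 0")
      case True
      then have "real (acc M) \<le> (\<Sum>M\<le>M0. real (acc M))"
        by (intro member_le_sum) auto
      also have "\<dots> \<le> D" using c by (simp add: D_def)
      also have "D \<le> D * (log 2 (real n))\<^sup>2"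
        using D c L2 mult_left_mono[of 1 "(log 2 (real n))\<^sup>2" D] by simp
      finally show ?thesis .
    next
      case False
      \<comment> \<open>The cube makes room for the \<open>+ 1\<close>; it triples the logarithm,
        whence the 9 in \<open>D\<close>.\<close>
      have "M \<le> n ^ 3"
      proof -
        have "n * n * 2 \<le> n * n * n" "1 \<le> n * n" using n by auto
        then show ?thesis using M unfolding power3_eq_cube by linarith
      qed
      then have "log 2 (real M) \<le> log 2 (real n ^ 3)"
        using False by (intro log_mono) (auto simp flip: of_nat_power)
      also have "\<dots> = 3 * log 2 (real n)"
        using n by (simp add: log_nat_power)
      finally have "(log 2 (real M))\<^sup>2 \<le> (3 * log 2 (real n))\<^sup>2"
        using False by (intro power_mono) auto
      then have "c * (log 2 (real M))\<^sup>2 \<le> c * (3 * log 2 (real n))\<^sup>2"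
        using c by (intro mult_left_mono) auto
      also have "\<dots> = 9 * c * (log 2 (real n))\<^sup>2"
        by (simp add: power_mult_distrib)
      also have "\<dots> \<le> D * (log 2 (real n))\<^sup>2"
        using D by (intro mult_right_mono) auto
      finally show ?thesis using M0[of M] False by simp
    qed
  qed
qed

section \<open>The asymptotic bound\<close>

theorem corollary2:
  fixes acc :: "nat \<Rightarrow> nat" and K :: real
  assumes circuit_oram: "(\<lambda>M. real (acc M)) \<in> O(\<lambda>M. (log 2 (real M))\<^sup>2)"
  shows "\<exists>C. \<forall>(n::nat) (G :: nat pair_pre_digraph) Ed Idx (l::nat) (s::rat).
           n \<ge> 2 \<and> pair_fin_digraph G \<and> pverts G = {1..n} \<and> edgelist_rep n G Ed Idx \<and>
           (real n \<le> K * real (card (parcs G)) \<or> real l \<le> K * real n) \<longrightarrow>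
           real (op_count (pagerank_protocol acc Ed Idx l s))
             \<le> C * ((real n ^ 2 + real (card (parcs G)) * real l) * (log 2 (real n))\<^sup>2)"
proof -
  obtain D where D: "D \<ge> 1"
    and acc: "\<And>n M. n \<ge> 2 \<Longrightarrow> M \<le> n * n + 1 \<Longrightarrow> real (acc M) \<le> D * (log 2 (real n))\<^sup>2"
    using oram_access_bound[OF circuit_oram] by blast
  show ?thesis
  \<comment> \<open>38 = 23 + 10 + 5 collects the terms in \<open>n^2\<close>, \<open>n\<close> and
    1, and also dominates the 17 of \<open>m * l\<close>; 8 = 3 + 5 collects those in
    \<open>n * l\<close> and \<open>l\<close>.\<close>
  proof (intro exI[of _ "(38 + 8 * \<bar>K\<bar>) * D"] allI impI, elim conjE)
    fix n l :: nat and G :: "nat pair_pre_digraph" and Ed Idx s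
    assume n: "n \<ge> 2" and G: "pair_fin_digraph G" "pverts G = {1..n}" "edgelist_rep n G Ed Idx"
      and K: "real n \<le> K * real (card (parcs G)) \<or> real l \<le> K * real n"
    define m where "m = card (parcs G)"
    define B where "B = D * (log 2 (real n))\<^sup>2"
    define W where "W = real n ^ 2 + real m * real l"
    note len = edgelist_length[OF G, folded m_def]
    have "log 2 (real n) \<ge> 1"
      using n by (simp add: le_log_iff)
    then have "1 * 1 \<le> D * (log 2 (real n))\<^sup>2"
      using D by (intro mult_mono one_le_power) auto
    then have B: "B \<ge> 1"
      by (simp add: B_def)
    \<comment> \<open>The size \<open>n * n + 1\<close> leaves room for \<open>Ed\<close>, which has
      \<open>m + 1\<close> entries with \<open>m \<le> n * n\<close>.\<close>
    interpret oram_cost acc "n * n + 1" B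
      by unfold_locales (use acc n B_def in auto)
    have "runs_within (pagerank_protocol acc Ed Idx l s)
     (real n * (real n * (6 * B + 17) + 3) + real n * (2 * B + 5) + 5
       + real l * (real m * (6 * B + 11) + real n * (B + 2) + 5)) (\<lambda>_. True)"
      by (rule runs_within_pagerank_protocol) (use len n in auto)
    then have "real (op_count (pagerank_protocol acc Ed Idx l s)) \<le>
      real n * (real n * (6 * B + 17) + 3) + real n * (2 * B + 5) + 5
       + real l * (real m * (6 * B + 11) + real n * (B + 2) + 5)"
      unfolding runs_within_def op_count_def by (metis add_0 of_nat_0)
    \<comment> \<open>Since \<open>B \<ge> 1\<close>, every constant \<open>a\<close> is at most
      \<open>a * B\<close>, so that \<open>B\<close> can be factored out.\<close>
    also have "\<dots> \<le> real n * (real n * (23 * B) + 3 * B) + real n * (7 * B) + 5 * B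
       + real l * (real m * (17 * B) + real n * (3 * B) + 5 * B)"
      using B by (intro add_mono mult_left_mono) auto
    also have "\<dots> = B * (23 * real n ^ 2 + 10 * real n + 5 + 17 * (real m * real l)
        + (3 * (real n * real l) + 5 * real l))"
      by (simp add: algebra_simps power2_eq_square)
    also have "\<dots> \<le> B * ((38 + 8 * \<bar>K\<bar>) * W)"
    proof (rule mult_left_mono)
      have n2: "real n \<le> real n ^ 2" "1 \<le> real n ^ 2"
        using n by (auto intro: self_le_power one_le_power)
      have ln: "real l \<le> real n * real l"
        using n by (cases l) auto
      \<comment> \<open>The absolute value keeps multiplication by the constant monotone, as
        \<open>K\<close> may have any sign.\<close>
      have "real n * real l \<le> \<bar>K\<bar> * W"
        using K
      proof
        assume "real n \<le> K * real (card (parcs G))"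
        then have "real n \<le> \<bar>K\<bar> * real m"
          unfolding m_def by (smt (verit) mult_right_mono of_nat_0_le_iff)
        then have "real n * real l \<le> \<bar>K\<bar> * real m * real l"
          by (intro mult_right_mono) auto
        also have "\<dots> \<le> \<bar>K\<bar> * W"
          unfolding W_def mult.assoc by (intro mult_left_mono) auto
        finally show ?thesis .
      next
        assume "real l \<le> K * real n"
        then have "real l \<le> \<bar>K\<bar> * real n"
          by (smt (verit) mult_right_mono of_nat_0_le_iff)
        then have "real n * real l \<le> real n * (\<bar>K\<bar> * real n)"
          by (intro mult_left_mono) auto
        also have "\<dots> = \<bar>K\<bar> * real n ^ 2"
          by (simp add: power2_eq_square)
        also have "\<dots> \<le> \<bar>K\<bar> * W"
          unfolding W_def by (intro mult_left_mono) auto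
        finally show ?thesis .
      qed
      moreover have "0 \<le> real m * real l" by simp
      ultimately have "23 * real n ^ 2 + 10 * real n + 5 + 17 * (real m * real l)
          + (3 * (real n * real l) + 5 * real l) \<le> 38 * W + 8 * (\<bar>K\<bar> * W)"
        using n2 ln W_def by linarith
      then show "23 * real n ^ 2 + 10 * real n + 5 + 17 * (real m * real l)
          + (3 * (real n * real l) + 5 * real l) \<le> (38 + 8 * \<bar>K\<bar>) * W"
        by (simp add: algebra_simps)
      show "0 \<le> B" using B by simp
    qed
    finally show "real (op_count (pagerank_protocol acc Ed Idx l s))
        \<le> (38 + 8 * \<bar>K\<bar>) * D * ((real n ^ 2 + real (card (parcs G)) * real l) * (log 2 (real n))\<^sup>2)"
      by (simp add: B_def W_def m_def mult_ac)
  qed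
qed

end
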